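(* There is an absolute constant $K>0$ such that for every perfect square $n$ and every stacking order $f$ of $\mathcal{D}(G_n)$, $$\lim_{\varepsilon\to 0}\mathrm{vis}(\mathcal{D}(\varepsilon G_n),f)\le K n^{2/3},$$ where $f$ also denotes the corresponding stacking order of $\mathcal{D}(\varepsilon G_n)$.
   Context: For a perfect square $n$, $G_n$ denotes the $n^{1/2}\times n^{1/2}$ uniform grid $\{(a,b)\in\mathbb{Z}^2: 1\le a,b\le n^{1/2}\}$. For a point $p$ in the plane, $D(p)$ denotes the closed disk of radius $1$ centered at $p$, and for a finite point set $P$, $\mathcal{D}(P)=\{D(p): p\in P\}$. A stacking order of a finite collection $\mathcal{D}$ of $n$ distinct unit disks is a bijection $f:\mathcal{D}\to\{1,\dots,n\}$; $f(D)$ is regarded as the height of $D$, and the arrangement is viewed from below. A point $x$ on the boundary circle of $D\in\mathcal{D}$ is visible if $x$ does not lie in any disk $D'\in\mathcal{D}$ with $f(D')<f(D)$. The visible perimeter $\mathrm{vis}(\mathcal{D},f)$ is the total length of all visible boundary points, summed over all disks of $\mathcal{D}$. For $\varepsilon>0$, $\varepsilon P=\{(\varepsilon x,\varepsilon y): (x,y)\in P\}$, and a stacking order $f$ of $\mathcal{D}(P)$ is identified with the stacking order $D(\varepsilon p)\mapsto f(D(p))$ of $\mathcal{D}(\varepsilon P)$. *)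

theory Defs
  imports "HOL-Analysis.Analysis"
begin

definition grid :: "nat \<Rightarrow> (real \<times> real) set" where
  "grid m = {(real a, real b) | a b. a \<in> {1..m} \<and> b \<in> {1..m}}"

text \<open>Unit disks are identified with their centers. A stacking order is a height function
  on the centers. The boundary point of D(p) at angle t is p + (cos t, sin t); it is visible
  iff it lies in no closed unit disk D(q) of smaller height, i.e. dist > 1 to every such q.
  Since the radius is 1, the length of the visible part of the circle equals the Lebesgue
  measure of the set of visible angles in [0, 2 pi).\<close>
definition vis :: "(real \<times> real) set \<Rightarrow> ((real \<times> real) \<Rightarrow> nat) \<Rightarrow> real" where
  "vis P h = (\<Sum>p\<in>P. measure lebesgue
      {t \<in> {0..<2*pi}. \<forall>q\<in>P. h q < h p \<longrightarrow> dist (p + (cos t, sin t)) q > 1})"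

definition scale_set :: "real \<Rightarrow> (real \<times> real) set \<Rightarrow> (real \<times> real) set" where
  "scale_set eps P = (\<lambda>p. eps *\<^sub>R p) ` P"

end

theory Submission
  imports Defs
begin

text \<open>As \<open>\<epsilon> \<rightarrow> 0\<close>, the boundary point of \<open>D(\<epsilon>p)\<close> in direction \<open>u\<close> is visible iff \<open>u \<cdot> p \<ge> u \<cdot> q\<close> for all
  lower \<open>q\<close>, so the limit is the sum over \<open>p\<close> of the lengths of the intervals \<open>I\<^sub>p\<close> of directions
  in which \<open>p\<close> is a record.  Let \<open>n = m\<^sup>2\<close>.  In the rational direction \<open>(b, a)\<close>, \<open>\<bar>a\<bar> \<le> b\<close>, the records
  are distinguished by the integer \<open>b x + a y\<close>, so there are only \<open>O(m b)\<close> of them.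

  Shrink every \<open>I\<^sub>p\<close> by \<open>\<theta>/2\<close> at both ends, which costs \<open>n \<theta>\<close> in total.  A slope \<open>x\<close> then lies in
  \<open>O(m d(x))\<close> shrunken intervals, where \<open>d(x)\<close> is the least denominator of a fraction within \<open>\<theta>/2\<close>
  of \<open>x\<close>.  By Dirichlet's theorem \<open>d(x) > Q\<close> forces \<open>x\<close> to be within \<open>1/(b Q)\<close> of some \<open>a/b\<close> with
  \<open>b < 2/(\<theta> Q)\<close>, a set of measure \<open>O(1/(\<theta> Q\<^sup>2))\<close>; summing over \<open>Q\<close> gives \<open>\<integral> d = O(\<theta>\<^bsup>-1/2\<^esup>)\<close>.  The
  choice \<open>\<theta> = 1/k\<^sup>2\<close> with \<open>k\<close> about \<open>m\<^bsup>1/3\<^esup>\<close> balances \<open>n \<theta>\<close> against \<open>m \<theta>\<^bsup>-1/2\<^esup>\<close>.\<close>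

section \<open>Diophantine approximation with small denominators on average\<close>

text \<open>Telescoping, from 1/(N+1)^2 <= 1/N - 1/(N+1). The term - 1/N makes the induction go
  through; at N = k the bound is 1/k^2 <= 1/k.\<close>

lemma sum_inverse_squares_le:
  fixes k N :: nat
  assumes "1 \<le> k" "k \<le> N"
  shows "(\<Sum>Q=k..N. 1 / (real Q)^2) \<le> 2 / real k - 1 / real N"
  using assms(2)
proof (induction N rule: dec_induct)
  case base
  have "1 / (real k)^2 \<le> 1 / real k"
    using assms by (simp add: field_simps power2_eq_square)
  then show ?case by simp
next
  case (step N)
  have N: "real N \<ge> 1" using assms step by simp
  have "1 / (real (Suc N))^2 \<le> 1 / (real N * real (Suc N))"
    using N by (intro divide_left_mono) (auto simp: power2_eq_square)
  also have "\<dots> = 1 / real N - 1 / real (Suc N)"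
    using N by (simp add: field_simps)
  finally show ?case using step by simp
qed

text \<open>The slopes x approximated by a/b to the precision that Dirichlet's theorem promises for
  denominators up to Q.\<close>

definition farey_arc :: "nat \<Rightarrow> nat \<Rightarrow> int \<Rightarrow> real set" where
  "farey_arc Q b a = {of_int a / real b - 1 / (real b * real Q) .. of_int a / real b + 1 / (real b * real Q)}"

text \<open>For fixed Q and b there are 4b + 1 <= 5b arcs of length 2/(bQ), contributing at most
  10/Q whatever b is. At most 2k^2/Q values of b then give 20 k^2/Q^2, and the tail of the inverse
  squares from k on is at most 2/k.\<close>

lemma sum_length_farey_arcs_le:
  fixes k :: nat
  assumes "1 \<le> k"
  shows "(\<Sum>Q=k..2*k^2. \<Sum>b=1..(2*k^2) div Q. \<Sum>a=-2*int b..2*int b. measure lborel (farey_arc Q b a))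
          \<le> 40 * real k"
proof -
  have "(\<Sum>b=1..(2*k^2) div Q. \<Sum>a=-2*int b..2*int b. measure lborel (farey_arc Q b a))
      \<le> 20 * (real k)^2 * (1 / (real Q)^2)" if Q: "Q \<in> {k..2*k^2}" for Q
  proof -
    have Q1: "real Q \<ge> 1" using Q assms by simp
    have "(\<Sum>a=-2*int b..2*int b. measure lborel (farey_arc Q b a)) \<le> 10 / real Q"
      if b: "b \<in> {1..(2*k^2) div Q}" for b
    proof -
      have b1: "real b \<ge> 1" using b by simp
      have "(\<Sum>a=-2*int b..2*int b. measure lborel (farey_arc Q b a))
          = real (nat (4 * int b + 1)) * (2 / (real b * real Q))"
        using b1 Q1 by (simp add: farey_arc_def)
      also have "\<dots> \<le> (5 * real b) * (2 / (real b * real Q))"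
        using b1 Q1 by (intro mult_right_mono) auto
      also have "\<dots> = 10 / real Q" using b1 by simp
      finally show ?thesis .
    qed
    then have "(\<Sum>b=1..(2*k^2) div Q. \<Sum>a=-2*int b..2*int b. measure lborel (farey_arc Q b a))
        \<le> (\<Sum>b=1..(2*k^2) div Q. 10 / real Q)" by (intro sum_mono) auto
    also have "\<dots> = real ((2*k^2) div Q) * (10 / real Q)" by simp
    also have "\<dots> \<le> (real (2*k^2) / real Q) * (10 / real Q)"
      using Q1 by (intro mult_right_mono of_nat_div_le_of_nat) auto
    also have "\<dots> = 20 * (real k)^2 * (1 / (real Q)^2)" by (simp add: power2_eq_square)
    finally show ?thesis .
  qed
  then have "(\<Sum>Q=k..2*k^2. \<Sum>b=1..(2*k^2) div Q. \<Sum>a=-2*int b..2*int b. measure lborel (farey_arc Q b a))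
      \<le> (\<Sum>Q=k..2*k^2. 20 * (real k)^2 * (1 / (real Q)^2))" by (intro sum_mono) auto
  also have "\<dots> = 20 * (real k)^2 * (\<Sum>Q=k..2*k^2. 1 / (real Q)^2)" by (simp add: sum_distrib_left)
  also have "\<dots> \<le> 20 * (real k)^2 * (2 / real k)"
  proof (rule mult_left_mono)
    have "k \<le> 2 * k^2" using assms by (simp add: power2_eq_square)
    from sum_inverse_squares_le[OF assms this]
    show "(\<Sum>Q=k..2*k^2. 1 / (real Q)^2) \<le> 2 / real k" by (smt (verit) of_nat_0_le_iff zero_le_divide_1_iff)
  qed simp
  also have "\<dots> = 40 * real k" using assms by (simp add: power2_eq_square)
  finally show ?thesis .
qed

text \<open>The triple sum is at least the number of \<open>Q \<ge> k\<close> below the least denominator, since each such \<open>Q\<close>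
  contributes an arc by Dirichlet's theorem.\<close>
lemma close_fraction_small_denominator:
  fixes x :: real and k :: nat
  assumes x: "x \<in> {-1..1}" and k: "1 \<le> k"
  obtains b :: nat and a :: int where "1 \<le> b" "\<bar>x - of_int a / real b\<bar> \<le> 1 / (2 * (real k)^2)"
    "real b \<le> real k + (\<Sum>Q=k..2*k^2. \<Sum>b=1..(2*k^2) div Q. \<Sum>a=-2*int b..2*int b. indicator (farey_arc Q b a) x)"
proof -
  define good where "good b \<longleftrightarrow> 1 \<le> b \<and> (\<exists>a::int. \<bar>x - of_int a / real b\<bar> \<le> 1 / (2 * (real k)^2))" for b :: nat
  define G where "G Q = (\<Sum>b=1..(2*k^2) div Q. \<Sum>a=-2*int b..2*int b. indicator (farey_arc Q b a) x :: real)" for Q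
  \<comment> \<open>The numerator bound makes the sum over a finite: |x| <= 1 and an error below 1
    in b x - a give |a| <= b + 1 <= 2b.\<close>
  have dirichlet: "\<exists>b a. 1 \<le> b \<and> b \<le> Q \<and> \<bar>a\<bar> \<le> 2 * int b \<and> \<bar>x - of_int a / real b\<bar> < 1 / (real b * real Q)"
    if Q: "1 \<le> Q" for Q :: nat
  proof -
    obtain a b where ab: "0 < b" "b \<le> int Q" "\<bar>of_int b * x - of_int a\<bar> < 1 / real Q"
      using Dirichlet_approx[of Q x] Q by (metis less_eq_Suc_le One_nat_def)
    have Q1: "1 / real Q \<le> 1" using Q by simp
    have "\<bar>of_int b * x\<bar> \<le> of_int b" using x ab(1) by (simp add: abs_mult mult_left_le abs_le_iff)
    then have "\<bar>real_of_int a\<bar> \<le> of_int b + 1" using ab(3) Q1 by linarith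
    then have "\<bar>a\<bar> \<le> b + 1" by linarith
    then have a: "\<bar>a\<bar> \<le> 2 * b" using ab(1) by linarith
    have "\<bar>x - of_int a / of_int b\<bar> = \<bar>of_int b * x - of_int a\<bar> / of_int b"
      using ab(1) by (simp add: field_simps abs_divide)
    also have "\<dots> < (1 / real Q) / of_int b" using ab by (intro divide_strict_right_mono) auto
    finally have "\<bar>x - of_int a / of_int b\<bar> < 1 / (of_int b * real Q)" by (simp add: mult.commute)
    then show ?thesis using ab a by (intro exI[of _ "nat b"] exI[of _ a]) auto
  qed
  have pos: "1 \<le> 2 * k^2" using k by simp
  have ex: "\<exists>b. good b"
  proof -
    obtain b a where ba: "1 \<le> b" "\<bar>x - of_int a / real b\<bar> < 1 / (real b * real (2*k^2))"
      using dirichlet[OF pos] by blast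
    have "1 / (real b * real (2*k^2)) \<le> 1 / (2 * (real k)^2)"
      using ba(1) k by (intro divide_left_mono) (auto simp: mult_le_cancel_right1)
    with ba have "\<bar>x - of_int a / real b\<bar> \<le> 1 / (2 * (real k)^2)" by linarith
    then show ?thesis unfolding good_def using ba(1) by blast
  qed
  define d where "d = (LEAST b. good b)"
  have d: "good d" unfolding d_def using ex by (rule LeastI_ex)
  have small: "\<not> good b" if "b < d" for b using not_less_Least that unfolding d_def by blast
  have G0: "G Q \<ge> 0" for Q unfolding G_def by (intro sum_nonneg) auto
  \<comment> \<open>The Dirichlet fraction for Q has denominator b <= Q < d, so by minimality of
    \<open>d\<close> its error exceeds 1/(2k^2), while it is below 1/(bQ). Hence bQ < 2k^2, which
    bounds both the range of b and that of Q.\<close>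
  have G1: "Q \<in> {k..2*k^2} \<and> G Q \<ge> 1" if Q: "Q \<in> {k..<d}" for Q
  proof -
    have Qk: "1 \<le> Q" using Q k by simp
    obtain b a where ba: "1 \<le> b" "b \<le> Q" "\<bar>a\<bar> \<le> 2 * int b" "\<bar>x - of_int a / real b\<bar> < 1 / (real b * real Q)"
      using dirichlet[OF Qk] by blast
    have "\<not> good b" using ba Q by (intro small) auto
    then have "1 / (2 * (real k)^2) < 1 / (real b * real Q)"
      unfolding good_def using ba(1,4) by (meson le_less_trans less_imp_le not_le)
    then have "real b * real Q < 2 * (real k)^2"
      using ba(1) Qk k by (simp add: field_simps)
    then have bQ: "b * Q < 2 * k^2"
      by (metis of_nat_less_iff of_nat_mult of_nat_numeral of_nat_power)
    have "b \<le> (2*k^2) div Q" using bQ Qk by (simp add: less_eq_div_iff_mult_less_eq)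
    then have b: "b \<in> {1..(2*k^2) div Q}" using ba by simp
    have a: "a \<in> {-2*int b..2*int b}" using ba by auto
    have "(1::real) = indicator (farey_arc Q b a) x" using ba(4) by (auto simp: farey_arc_def indicator_def abs_less_iff)
    also have "\<dots> \<le> (\<Sum>a=-2*int b..2*int b. indicator (farey_arc Q b a) x)"
      using a by (intro member_le_sum) auto
    also have "\<dots> \<le> G Q" unfolding G_def using b
      by (intro member_le_sum[where f="\<lambda>b. \<Sum>a=-2*int b..2*int b. indicator (farey_arc Q b a) x"] sum_nonneg) auto
    finally have "G Q \<ge> 1" .
    moreover have "1 * Q \<le> b * Q" using ba(1) by (rule mult_right_mono) simp
    then have "Q \<le> 2 * k^2" using bQ by linarith
    ultimately show ?thesis using Q by auto
  qed
  \<comment> \<open>If d <= k the sum is empty and the inequality still holds.\<close>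
  have "real d \<le> real k + (\<Sum>Q\<in>{k..<d}. 1)" by simp
  also have "(\<Sum>Q\<in>{k..<d}. 1) \<le> (\<Sum>Q\<in>{k..<d}. G Q)" using G1 by (intro sum_mono) auto
  also have "\<dots> \<le> (\<Sum>Q=k..2*k^2. G Q)" using G0 G1 by (intro sum_mono2) auto
  finally have "real d \<le> real k + (\<Sum>Q=k..2*k^2. G Q)" by simp
  with d that show ?thesis unfolding good_def G_def by blast
qed

section \<open>Counting records by slope\<close>

text \<open>Since \<open>h\<close> is injective, any two records are comparable in height, and the
  higher one has strictly larger b X + a Y. So this integer determines the record, and it lies
  between -2bm and 2bm, which leaves 4bm + 1 <= 5bm values.\<close>

lemma card_records_le:
  fixes X Y :: "'a \<Rightarrow> int" and h :: "'a \<Rightarrow> nat" and a :: int and b m :: nat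
  assumes inj: "inj_on h R" and m: "1 \<le> m" and b: "1 \<le> b" and a: "\<bar>a\<bar> \<le> int b"
    and bound: "\<And>p. p \<in> R \<Longrightarrow> \<bar>X p\<bar> \<le> int m \<and> \<bar>Y p\<bar> \<le> int m"
    and rec: "\<And>p q. p \<in> R \<Longrightarrow> q \<in> R \<Longrightarrow> h q < h p \<Longrightarrow> int b * (X p - X q) + a * (Y p - Y q) > 0"
  shows "card R \<le> 5 * m * b"
proof -
  define g where "g p = int b * X p + a * Y p" for p
  have "inj_on g R"
  proof (rule inj_onI)
    fix p q assume pq: "p \<in> R" "q \<in> R" "g p = g q"
    have "\<not> h p < h q" "\<not> h q < h p"
      using rec[OF pq(1,2)] rec[OF pq(2,1)] pq(3) by (auto simp: g_def algebra_simps)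
    then show "p = q" using inj pq by (auto simp: inj_on_def)
  qed
  moreover have "g ` R \<subseteq> {- (2 * int b * int m)..2 * int b * int m}"
  proof
    fix z assume "z \<in> g ` R"
    then obtain p where p: "p \<in> R" "z = g p" by auto
    have "\<bar>int b * X p\<bar> \<le> int b * int m" "\<bar>a * Y p\<bar> \<le> int b * int m"
      using bound[OF p(1)] a by (auto simp: abs_mult intro!: mult_mono)
    then show "z \<in> {- (2 * int b * int m)..2 * int b * int m}" unfolding p g_def atLeastAtMost_iff by linarith
  qed
  ultimately have "card R \<le> card {- (2 * int b * int m)..2 * int b * int m}"
    by (intro card_inj_on_le) auto
  also have "\<dots> = nat (int (4 * b * m + 1))" by simp
  also have "\<dots> = 4 * b * m + 1" by (rule nat_int)
  also have "\<dots> \<le> 5 * m * b" using m b by (simp add: Suc_le_eq)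
  finally show ?thesis .
qed

text \<open>The slope \<open>x\<close> stands for the direction \<open>(1, x)\<close>.\<close>
definition slopes :: "'a set \<Rightarrow> ('a \<Rightarrow> nat) \<Rightarrow> ('a \<Rightarrow> int) \<Rightarrow> ('a \<Rightarrow> int) \<Rightarrow> 'a \<Rightarrow> real set" where
  "slopes P h X Y p = {x \<in> {-1..1}. \<forall>q\<in>P. h q < h p \<longrightarrow> of_int (X p - X q) + x * of_int (Y p - Y q) \<ge> 0}"

text \<open>Each condition is affine in the slope, so the set is compact and convex on the line; the
  empty set is covered by l > r.\<close>

lemma slopes_interval: "\<exists>l r. slopes P h X Y p = {l..r}"
proof -
  have eq: "slopes P h X Y p = {-1..1} \<inter> (\<Inter>q\<in>{q\<in>P. h q < h p}. {x. of_int (X p - X q) + x * of_int (Y p - Y q) \<ge> 0})"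
    by (auto simp: slopes_def)
  have "compact (slopes P h X Y p)" unfolding eq
    by (intro compact_Int_closed closed_INT ballI closed_Collect_le continuous_intros) auto
  moreover have "convex (slopes P h X Y p)" unfolding eq
  proof (intro convex_Int convex_INT)
    fix q
    show "convex {x. 0 \<le> real_of_int (X p - X q) + x * real_of_int (Y p - Y q)}"
    proof (rule convexI)
      fix x y u v :: real
      assume H: "x \<in> {x. 0 \<le> real_of_int (X p - X q) + x * real_of_int (Y p - Y q)}"
        "y \<in> {x. 0 \<le> real_of_int (X p - X q) + x * real_of_int (Y p - Y q)}" "0 \<le> u" "0 \<le> v" "u + v = 1"
      have "0 \<le> u * (real_of_int (X p - X q) + x * real_of_int (Y p - Y q)) + v * (real_of_int (X p - X q) + y * real_of_int (Y p - Y q))"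
        using H by simp
      also have "\<dots> = (u + v) * real_of_int (X p - X q) + (u * x + v * y) * real_of_int (Y p - Y q)"
        by (simp only: algebra_simps)
      finally show "u *\<^sub>R x + v *\<^sub>R y \<in> {x. 0 \<le> real_of_int (X p - X q) + x * real_of_int (Y p - Y q)}"
        using H by simp
    qed
  qed simp
  ultimately show ?thesis by (metis is_interval_compact is_interval_convex_1 box_real(2))
qed

text \<open>The total length of the shrunken intervals is the integral of the number of them
  covering x. The coordinates \<open>X\<close> and \<open>Y\<close> are left abstract so that
  rotated ones can be substituted.\<close>

lemma sum_slopes_le:
  fixes X Y :: "'a \<Rightarrow> int" and h :: "'a \<Rightarrow> nat" and m k :: nat
  assumes fin: "finite P" and inj: "inj_on h P" and injXY: "inj_on (\<lambda>p. (X p, Y p)) P"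
    and m: "1 \<le> m" and k: "1 \<le> k"
    and bound: "\<And>p. p \<in> P \<Longrightarrow> \<bar>X p\<bar> \<le> int m \<and> \<bar>Y p\<bar> \<le> int m"
  shows "(\<Sum>p\<in>P. measure lborel (slopes P h X Y p)) \<le> real (card P) / (real k)^2 + 210 * real m * real k"
proof -
  define e where "e = 1 / (2 * (real k)^2)"
  have e: "e > 0" using k by (simp add: e_def)
  obtain l r where lr: "\<And>p. slopes P h X Y p = {l p..r p}"
    using slopes_interval[of P h X Y] by metis
  \<comment> \<open>Fractions within \<open>e\<close> of \<open>W p\<close> are interior to the slope interval of \<open>p\<close>, where the
    defining inequalities are strict.\<close>
  define W where "W p = {l p + e<..<r p - e}" for p
  define F where "F x = (\<Sum>Q=k..2*k^2. \<Sum>b=1..(2*k^2) div Q. \<Sum>a=-2*int b..2*int b. indicator (farey_arc Q b a) x :: real)" for x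
  have W1: "x \<in> {-1..1}" if "x \<in> W p" for x p
  proof -
    have "x \<in> slopes P h X Y p" using that e unfolding lr W_def by auto
    then show ?thesis by (simp add: slopes_def)
  qed
  \<comment> \<open>An affine function that is nonnegative at both ends of an interval and zero
    inside it vanishes identically; here that would give p and q the same coordinates.\<close>
  have strict: "of_int (X p - X q) + y * of_int (Y p - Y q) > 0"
    if "p \<in> P" "q \<in> P" "h q < h p" "l p < y" "y < r p" for p q y
  proof -
    have nn: "of_int (X p - X q) + x * of_int (Y p - Y q) \<ge> 0" if "x \<in> {l p..r p}" for x
      using that \<open>q \<in> P\<close> \<open>h q < h p\<close> unfolding lr[symmetric] slopes_def by auto
    have "of_int (X p - X q) + y * of_int (Y p - Y q) \<noteq> 0"
    proof
      assume z: "of_int (X p - X q) + y * of_int (Y p - Y q) = 0"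
      have "(l p - y) * of_int (Y p - Y q) \<ge> 0" "(r p - y) * of_int (Y p - Y q) \<ge> 0"
        using nn[of "l p"] nn[of "r p"] z that by (auto simp: algebra_simps)
      then have "real_of_int (Y p - Y q) = 0" using that(4,5)
        by (smt (verit) mult_neg_pos mult_pos_neg zero_le_mult_iff)
      then have "Y p = Y q" "X p = X q" using z by auto
      then show False using injXY that by (auto simp: inj_on_def)
    qed
    then show ?thesis using nn[of y] that by force
  qed
  have key: "(\<Sum>p\<in>P. indicator (W p) x) \<le> 5 * real m * (real k * indicator {-1..1} x + F x)" for x :: real
  proof (cases "x \<in> {-1..1}")
    case False
    then have "(\<Sum>p\<in>P. indicator (W p) x) = (0::real)" using W1 by (intro sum.neutral) (auto simp: indicator_def)
    moreover have "F x \<ge> 0" unfolding F_def by (intro sum_nonneg) auto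
    ultimately show ?thesis by simp
  next
    case True
    obtain b a where ba: "1 \<le> b" "\<bar>x - of_int a / real b\<bar> \<le> e" "real b \<le> real k + F x"
      using close_fraction_small_denominator[OF True k] unfolding e_def F_def by blast
    \<comment> \<open>One fraction a/b serves all intervals covering x at once: being within
      \<open>e\<close> of x, it is interior to the slope interval of every p in
      \<open>R\<close>.\<close>
    define R where "R = {p\<in>P. x \<in> W p}"
    have y: "l p < of_int a / real b \<and> of_int a / real b < r p" if "p \<in> R" for p
      using that ba(2) unfolding R_def W_def by auto
    have "card R \<le> 5 * m * b"
    proof (cases "R = {}")
      case False
      then obtain p where p: "p \<in> R" by auto
      have "of_int a / real b \<in> slopes P h X Y p" using y[OF p] unfolding lr by auto
      \<comment> \<open>The fraction may a priori leave [-1, 1]; a member of \<open>R\<close> rules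
        this out, hence the split on \<open>R\<close> being empty.\<close>
      then have "\<bar>of_int a / real b\<bar> \<le> 1" by (auto simp: slopes_def)
      then have "\<bar>real_of_int a\<bar> \<le> real b" using ba(1) by (simp add: abs_divide)
      then have a: "\<bar>a\<bar> \<le> int b" by linarith
      show ?thesis
      proof (rule card_records_le[where X=X and Y=Y and h=h and a=a])
        show "inj_on h R" using inj by (rule inj_on_subset) (auto simp: R_def)
        fix p assume p: "p \<in> R"
        then show "\<bar>X p\<bar> \<le> int m \<and> \<bar>Y p\<bar> \<le> int m" using bound by (auto simp: R_def)
        fix q assume q: "q \<in> R" "h q < h p"
        have "0 < of_int (X p - X q) + (of_int a / real b) * of_int (Y p - Y q)"
          by (rule strict) (use p q y in \<open>auto simp: R_def\<close>)
        then have "0 < real b * (of_int (X p - X q) + (of_int a / real b) * of_int (Y p - Y q))"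
          using ba(1) by simp
        also have "\<dots> = of_int (int b * (X p - X q) + a * (Y p - Y q))"
          using ba(1) by (simp add: distrib_left)
        finally show "0 < int b * (X p - X q) + a * (Y p - Y q)" by linarith
      qed (use m ba a in auto)
    qed simp
    have "(\<Sum>p\<in>P. indicator (W p) x) = real (card R)"
      using fin by (simp add: R_def indicator_def sum.If_cases Int_def)
    also have "\<dots> \<le> real (5 * m * b)" using \<open>card R \<le> 5 * m * b\<close> by (rule of_nat_mono)
    also have "\<dots> = 5 * real m * real b" by simp
    also have "\<dots> \<le> 5 * real m * (real k + F x)" using ba(3) by (intro mult_left_mono) auto
    finally show ?thesis using True by simp
  qed
  have Wi: "integrable lborel (\<lambda>x. indicator (W p) x :: real)" for p
    unfolding W_def by (cases "l p + e \<le> r p - e") auto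
  have ai: "integrable lborel (\<lambda>x. indicator (farey_arc Q b a) x :: real)" for Q b a
    unfolding farey_arc_def
    by (intro integrable_real_indicator) (auto simp: emeasure_lborel_Icc_eq)
  have Fi: "integrable lborel F"
    unfolding F_def using ai by (intro Bochner_Integration.integrable_sum) 
  have FI: "(LINT x|lborel. F x) = (\<Sum>Q=k..2*k^2. \<Sum>b=1..(2*k^2) div Q. \<Sum>a=-2*int b..2*int b. measure lborel (farey_arc Q b a))"
    unfolding F_def by (subst Bochner_Integration.integral_sum, (intro Bochner_Integration.integrable_sum ai)[1])+ simp
  have ci: "integrable lborel (\<lambda>x::real. indicator {-1..1} x :: real)" by simp
  have "(\<Sum>p\<in>P. measure lborel (W p)) = (LINT x|lborel. (\<Sum>p\<in>P. indicator (W p) x))"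
    using Wi by (subst Bochner_Integration.integral_sum) auto
  also have "\<dots> \<le> (LINT x|lborel. 5 * real m * (real k * indicator {-1..1} x + F x))"
    using key Wi Fi ci by (intro integral_mono Bochner_Integration.integrable_sum) auto
  also have "\<dots> = 5 * real m * (real k * 2 + (LINT x|lborel. F x))"
    using Fi ci by simp
  \<comment> \<open>The 2 is the length of [-1, 1], the 40 comes from the arcs, and 5 (2 + 40) =
    210.\<close>
  also have "\<dots> \<le> 5 * real m * (real k * 2 + 40 * real k)"
    unfolding FI using sum_length_farey_arcs_le[OF k] by (intro mult_left_mono add_left_mono) auto
  finally have W: "(\<Sum>p\<in>P. measure lborel (W p)) \<le> 210 * real m * real k" by simp
  \<comment> \<open>The two cuts lose at most 2e; an interval shorter than that disappears, but its
    length is then below the loss.\<close>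
  have "measure lborel (slopes P h X Y p) \<le> measure lborel (W p) + 1 / (real k)^2" for p
  proof -
    have "1 / (real k)^2 = 2 * e" by (simp add: e_def)
    then show ?thesis unfolding lr W_def using e
      by (cases "l p \<le> r p"; cases "l p + e \<le> r p - e") auto
  qed
  then have "(\<Sum>p\<in>P. measure lborel (slopes P h X Y p)) \<le> (\<Sum>p\<in>P. measure lborel (W p) + 1 / (real k)^2)"
    by (intro sum_mono)
  also have "\<dots> = (\<Sum>p\<in>P. measure lborel (W p)) + real (card P) / (real k)^2"
    by (simp add: sum.distrib)
  finally show ?thesis using W by linarith
qed


section \<open>From slopes to angles\<close>

text \<open>The directions in which p is a weak record against all lower points: the limit, as eps
  tends to 0, of the visible angles of p.\<close>

definition critical_angles :: "'a set \<Rightarrow> ('a \<Rightarrow> nat) \<Rightarrow> ('a \<Rightarrow> int) \<Rightarrow> ('a \<Rightarrow> int) \<Rightarrow> 'a \<Rightarrow> real set" where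
  "critical_angles P h X Y p =
     {t \<in> {0..<2*pi}. \<forall>q\<in>P. h q < h p \<longrightarrow> of_int (X p - X q) * cos t + of_int (Y p - Y q) * sin t \<ge> 0}"

lemma arctan_diff_le:
  fixes l r :: real
  assumes "l \<le> r"
  shows "arctan r - arctan l \<le> r - l"
proof -
  have "l - arctan l \<le> r - arctan r"
  proof (rule DERIV_nonneg_imp_nondecreasing[OF assms])
    fix x :: real
    have "((\<lambda>x. x - arctan x) has_real_derivative 1 - inverse (1 + x\<^sup>2)) (at x)"
      by (auto intro!: derivative_eq_intros)
    moreover have "0 \<le> 1 - inverse (1 + x\<^sup>2)" by (simp add: field_simps add_pos_nonneg)
    ultimately show "\<exists>y. ((\<lambda>x. x - arctan x) has_real_derivative y) (at x) \<and> 0 \<le> y" by blast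
  qed
  then show ?thesis by simp
qed

text \<open>Rotating by -c turns the sector into |s| <= pi/4 with s = t - c, and \<open>A\<close>,
  \<open>B\<close> keep the coordinates integral. Dividing by cos s > 0 turns the angle condition
  into the slope condition for tan s. Lengths do not grow on the way back because
  \<open>arctan\<close> is 1-Lipschitz.\<close>

lemma measure_sector_le:
  fixes X Y :: "'a \<Rightarrow> int" and A B :: int
  assumes c: "cos c = of_int A" "sin c = of_int B"
    and meas: "critical_angles P h X Y p \<in> sets lebesgue"
  shows "measure lebesgue (critical_angles P h X Y p \<inter> {c - pi/4..c + pi/4})
          \<le> measure lborel (slopes P h (\<lambda>p. A * X p + B * Y p) (\<lambda>p. A * Y p - B * X p) p)"
proof -
  let ?X = "\<lambda>p. A * X p + B * Y p" and ?Y = "\<lambda>p. A * Y p - B * X p"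
  obtain l r where lr: "slopes P h ?X ?Y p = {l..r}" using slopes_interval[of P h ?X ?Y p] by (elim exE)
  have *: "tan (t - c) \<in> {l..r} \<and> t = c + arctan (tan (t - c))"
    if t: "t \<in> critical_angles P h X Y p" "t \<in> {c - pi/4..c + pi/4}" for t
  proof -
    define s where "s = t - c"
    have s: "-(pi/4) \<le> s" "s \<le> pi/4" using t(2) by (auto simp: s_def)
    have pi: "pi > 0" by simp
    have s': "-(pi/2) < s" "s < pi/2" using s pi by linarith+
    have cs: "cos s > 0" using s' by (rule cos_gt_zero_pi)
    have tan1: "tan s \<in> {-1..1}"
      using tan_mono_le[of s "pi/4"] tan_mono_le[of "-(pi/4)" s] s pi by (simp add: tan_45)
    have ct: "cos t = of_int A * cos s - of_int B * sin s" "sin t = of_int B * cos s + of_int A * sin s"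
      using cos_add[of c s] sin_add[of c s] c by (auto simp: s_def algebra_simps)
    have "of_int (?X p - ?X q) + tan s * of_int (?Y p - ?Y q) \<ge> 0" if q: "q \<in> P" "h q < h p" for q
    proof -
      have "0 \<le> of_int (X p - X q) * cos t + of_int (Y p - Y q) * sin t"
        using t(1) q by (auto simp: critical_angles_def)
      also have "\<dots> = cos s * (of_int (?X p - ?X q) + tan s * of_int (?Y p - ?Y q))"
        using cs unfolding ct by (simp add: tan_def distrib_left) (simp only: algebra_simps)
      finally show ?thesis using cs by (simp add: zero_le_mult_iff)
    qed
    then have "tan s \<in> slopes P h ?X ?Y p" using tan1 by (auto simp: slopes_def)
    moreover have "arctan (tan s) = s" using s' by (rule arctan_tan)
    ultimately show ?thesis unfolding lr by (simp add: s_def)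
  qed
  show ?thesis
  proof (cases "l \<le> r")
    case False
    then have "critical_angles P h X Y p \<inter> {c - pi/4..c + pi/4} = {}" using * by fastforce
    then show ?thesis by simp
  next
    case True
    have "critical_angles P h X Y p \<inter> {c - pi/4..c + pi/4} \<subseteq> {c + arctan l..c + arctan r}"
    proof
      fix t assume "t \<in> critical_angles P h X Y p \<inter> {c - pi/4..c + pi/4}"
      then have "l \<le> tan (t - c)" "tan (t - c) \<le> r" and t: "t = c + arctan (tan (t - c))" using *[of t] by auto
      then have "arctan l \<le> arctan (tan (t - c))" "arctan (tan (t - c)) \<le> arctan r"
        by (auto simp: arctan_le_iff)
      then show "t \<in> {c + arctan l..c + arctan r}" using t by auto
    qed
    then have "measure lebesgue (critical_angles P h X Y p \<inter> {c - pi/4..c + pi/4})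
        \<le> measure lebesgue {c + arctan l..c + arctan r}"
      using meas by (intro measure_mono_fmeasurable) auto
    also have "\<dots> = arctan r - arctan l" using True by (simp add: arctan_le_iff)
    also have "\<dots> \<le> r - l" using True by (rule arctan_diff_le)
    finally show ?thesis unfolding lr using True by simp
  qed
qed

lemma critical_angles_measurable: "critical_angles P h X Y p \<in> sets lebesgue"
proof -
  have eq: "critical_angles P h X Y p = {0..<2*pi} \<inter>
      (\<Inter>q\<in>{q\<in>P. h q < h p}. {t. of_int (X p - X q) * cos t + of_int (Y p - Y q) * sin t \<ge> 0})"
    by (auto simp: critical_angles_def)
  have "closed (\<Inter>q\<in>{q\<in>P. h q < h p}. {t. of_int (X p - X q) * cos t + of_int (Y p - Y q) * sin t \<ge> (0::real)})"
    by (intro closed_INT ballI closed_Collect_le continuous_intros)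
  then have "critical_angles P h X Y p \<in> sets borel" unfolding eq by (intro sets.Int) (auto intro: borel_closed)
  then show ?thesis by simp
qed

text \<open>Quarter-circle sectors centred at multiples of pi/2 reduce this to
  \<open>sum_slopes_le\<close>. There are five of them because [0, 2 pi) is not taken cyclically:
  angles just below 2 pi need the sector centred at 2 pi.\<close>

lemma sum_critical_angles_le:
  fixes X Y :: "'a \<Rightarrow> int" and h :: "'a \<Rightarrow> nat" and m k :: nat
  assumes fin: "finite P" and inj: "inj_on h P" and injXY: "inj_on (\<lambda>p. (X p, Y p)) P"
    and m: "1 \<le> m" and k: "1 \<le> k"
    and bound: "\<And>p. p \<in> P \<Longrightarrow> \<bar>X p\<bar> \<le> int m \<and> \<bar>Y p\<bar> \<le> int m"
  shows "(\<Sum>p\<in>P. measure lebesgue (critical_angles P h X Y p))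
          \<le> 5 * (real (card P) / (real k)^2 + 210 * real m * real k)"
proof -
  define c where "c i = real i * (pi/2)" for i :: nat
  define V where "V p i = critical_angles P h X Y p \<inter> {c i - pi/4..c i + pi/4}" for p i
  have five: "{..<5::nat} = {0,1,2,3,4}" by auto
  have V: "V p i \<in> fmeasurable lebesgue" for p i
    unfolding V_def Int_commute[of "critical_angles P h X Y p"]
    by (intro fmeasurable_Int_fmeasurable critical_angles_measurable) auto
  have cover: "critical_angles P h X Y p \<subseteq> (\<Union>i<5. V p i)" for p
  proof
    fix t assume t: "t \<in> critical_angles P h X Y p"
    have "0 \<le> t" "t < 2 * pi" using t by (auto simp: critical_angles_def)
    then have "\<exists>i\<in>{0,1,2,3,4}. t \<in> {c i - pi/4..c i + pi/4}" using pi_gt_zero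
      unfolding c_def by (simp; linarith)
    then show "t \<in> (\<Union>i<5. V p i)" unfolding V_def five using t by blast
  qed
  \<comment> \<open>A quarter turn sends (A, B) to (-B, A), so the rotated coordinates are the old
    ones up to order and sign, and the bound by m persists.\<close>
  have rotation: "\<exists>A B :: int. cos (c i) = of_int A \<and> sin (c i) = of_int B \<and>
      (\<bar>A\<bar> = 1 \<and> B = 0 \<or> A = 0 \<and> \<bar>B\<bar> = 1)" for i
  proof (induction i)
    case 0
    then show ?case by (intro exI[of _ 1] exI[of _ 0]) (auto simp: c_def)
  next
    case (Suc i)
    then obtain A B :: int where AB: "cos (c i) = of_int A" "sin (c i) = of_int B"
      "\<bar>A\<bar> = 1 \<and> B = 0 \<or> A = 0 \<and> \<bar>B\<bar> = 1" by blast
    have "c (Suc i) = c i + pi/2" by (simp add: c_def algebra_simps add_divide_distrib)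
    then show ?case using AB by (intro exI[of _ "-B"] exI[of _ A]) (auto simp: cos_add sin_add)
  qed
  have "(\<Sum>p\<in>P. measure lebesgue (V p i)) \<le> real (card P) / (real k)^2 + 210 * real m * real k" for i
  proof -
    obtain A B :: int where AB: "cos (c i) = of_int A" "sin (c i) = of_int B"
      "\<bar>A\<bar> = 1 \<and> B = 0 \<or> A = 0 \<and> \<bar>B\<bar> = 1" using rotation by blast
    have "(\<Sum>p\<in>P. measure lebesgue (V p i))
        \<le> (\<Sum>p\<in>P. measure lborel (slopes P h (\<lambda>p. A * X p + B * Y p) (\<lambda>p. A * Y p - B * X p) p))"
      unfolding V_def by (intro sum_mono measure_sector_le AB critical_angles_measurable)
    also have "\<dots> \<le> real (card P) / (real k)^2 + 210 * real m * real k"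
    proof (rule sum_slopes_le[OF fin inj _ m k])
      show "inj_on (\<lambda>p. (A * X p + B * Y p, A * Y p - B * X p)) P"
        using injXY AB(3) by (auto simp: inj_on_def)
      show "\<bar>A * X p + B * Y p\<bar> \<le> int m \<and> \<bar>A * Y p - B * X p\<bar> \<le> int m" if "p \<in> P" for p
        using bound[OF that] AB(3) by (auto simp: abs_mult)
    qed
    finally show ?thesis .
  qed
  then have "(\<Sum>i<5. \<Sum>p\<in>P. measure lebesgue (V p i)) \<le> (\<Sum>i<5::nat. real (card P) / (real k)^2 + 210 * real m * real k)"
    by (intro sum_mono)
  moreover have "measure lebesgue (critical_angles P h X Y p) \<le> (\<Sum>i<5. measure lebesgue (V p i))" for p
  proof -
    have "measure lebesgue (critical_angles P h X Y p) \<le> measure lebesgue (\<Union>i<5. V p i)"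
      using cover critical_angles_measurable V by (intro measure_mono_fmeasurable fmeasurable.finite_UN) auto
    also have "\<dots> \<le> (\<Sum>i<5. measure lebesgue (V p i))" using V by (intro measure_UNION_le) (auto dest: fmeasurableD)
    finally show ?thesis .
  qed
  then have "(\<Sum>p\<in>P. measure lebesgue (critical_angles P h X Y p)) \<le> (\<Sum>p\<in>P. \<Sum>i<5. measure lebesgue (V p i))"
    by (intro sum_mono)
  moreover have "(\<Sum>p\<in>P. \<Sum>i<5. measure lebesgue (V p i)) = (\<Sum>i<5. \<Sum>p\<in>P. measure lebesgue (V p i))"
    by (rule sum.swap)
  ultimately show ?thesis by simp
qed

section \<open>The limit of the visible angles\<close>

text \<open>For the unit vector u = (cos t, sin t), the squared distance expands to 1 + 2 eps (u .
  (p - q) + eps |p - q|^2 / 2).\<close>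

lemma dist_scaled_gt_1_iff:
  fixes p q :: "real \<times> real"
  assumes "eps > 0"
  shows "dist (eps *\<^sub>R p + (cos t, sin t)) (eps *\<^sub>R q) > 1 \<longleftrightarrow>
    (fst p - fst q) * cos t + (snd p - snd q) * sin t + eps * ((fst p - fst q)^2 + (snd p - snd q)^2) / 2 > 0"
proof -
  obtain x y x' y' where pq: "p = (x, y)" "q = (x', y')" by fastforce
  have "(dist (eps *\<^sub>R p + (cos t, sin t)) (eps *\<^sub>R q))\<^sup>2
      = (eps * (x - x') + cos t)^2 + (eps * (y - y') + sin t)^2"
    by (simp add: pq dist_Pair_Pair dist_real_def algebra_simps)
  also have "\<dots> = ((sin t)^2 + (cos t)^2) + 2 * eps * ((x - x') * cos t + (y - y') * sin t + eps * ((x - x')^2 + (y - y')^2) / 2)"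
    by algebra
  finally have "(dist (eps *\<^sub>R p + (cos t, sin t)) (eps *\<^sub>R q))\<^sup>2
      = 1 + 2 * eps * ((x - x') * cos t + (y - y') * sin t + eps * ((x - x')^2 + (y - y')^2) / 2)" by simp
  moreover have "d > 1 \<longleftrightarrow> d\<^sup>2 > 1" if "d \<ge> 0" for d :: real
    using that power_less_imp_less_base[of 1 2 d] by (auto simp: one_less_power)
  ultimately show ?thesis using assms by (simp add: pq zero_less_mult_iff)
qed

text \<open>Along a decreasing sequence of eps the positive correction eps |p - q|^2 / 2 shrinks, so
  the visible sets decrease and continuity from above applies. As the correction vanishes in the
  limit but is positive for every eps, the strict conditions intersect to the weak ones.\<close>

lemma tendsto_measure_visible:
  fixes P :: "(real \<times> real) set" and X Y :: "real \<times> real \<Rightarrow> int"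
  assumes fin: "finite P" and coords: "\<And>p. p \<in> P \<Longrightarrow> p = (of_int (X p), of_int (Y p))" and p: "p \<in> P"
  shows "((\<lambda>eps. measure lebesgue {t \<in> {0..<2*pi}. \<forall>q\<in>P. h q < h p \<longrightarrow>
              dist (eps *\<^sub>R p + (cos t, sin t)) (eps *\<^sub>R q) > 1})
          \<longlongrightarrow> measure lebesgue (critical_angles P h X Y p)) (at_right 0)"
proof (rule tendsto_at_right_sequentially[of 0 1])
  fix S :: "nat \<Rightarrow> real"
  assume S: "\<And>n. 0 < S n" "decseq S" "S \<longlonglongrightarrow> 0"
  define L where "L q t = (fst p - fst q) * cos t + (snd p - snd q) * sin t" for q t
  define c where "c q = ((fst p - fst q)^2 + (snd p - snd q)^2) / 2" for q
  define V where "V n = {t \<in> {0..<2*pi}. \<forall>q\<in>P. h q < h p \<longrightarrow> L q t + S n * c q > 0}" for n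
  have c0: "c q \<ge> 0" for q by (simp add: c_def)
  have cpos: "c q > 0" if "p \<noteq> q" for q
    using that by (auto simp: c_def prod_eq_iff sum_power2_gt_zero_iff)
  have eqV: "{t \<in> {0..<2*pi}. \<forall>q\<in>P. h q < h p \<longrightarrow> dist (S n *\<^sub>R p + (cos t, sin t)) (S n *\<^sub>R q) > 1} = V n" for n
    unfolding V_def by (simp only: dist_scaled_gt_1_iff[OF S(1)] L_def c_def times_divide_eq_right)
  have Vm: "V n \<in> sets borel" for n
  proof -
    have "V n = {0..<2*pi} \<inter> (\<Inter>q\<in>{q\<in>P. h q < h p}. {t. L q t + S n * c q > 0})" by (auto simp: V_def)
    moreover have "open (\<Inter>q\<in>{q\<in>P. h q < h p}. {t. L q t + S n * c q > 0})"
      unfolding L_def using fin by (intro open_INT ballI open_Collect_less continuous_intros) auto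
    ultimately show ?thesis by simp
  qed
  have fm: "V n \<in> lmeasurable" for n
  proof (rule fmeasurableI2)
    show "{0..2*pi} \<in> lmeasurable" by simp
    show "V n \<subseteq> {0..2*pi}" by (auto simp: V_def)
    show "V n \<in> sets lebesgue" using Vm by simp
  qed
  have dec: "decseq V"
  proof (rule decseq_SucI, rule subsetI)
    fix n t assume t: "t \<in> V (Suc n)"
    have "S (Suc n) * c q \<le> S n * c q" for q using decseq_SucD[OF S(2)] c0 by (intro mult_right_mono) auto
    then have "0 < L q t + S (Suc n) * c q \<Longrightarrow> 0 < L q t + S n * c q" for q by (meson add_left_mono less_le_trans)
    then show "t \<in> V n" using t unfolding V_def by blast
  qed
  have "(\<Inter>n. V n) = critical_angles P h X Y p"
  proof -
    have "(\<forall>n. L q t + S n * c q > 0) \<longleftrightarrow> of_int (X p - X q) * cos t + of_int (Y p - Y q) * sin t \<ge> 0"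
      if q: "q \<in> P" "h q < h p" for q t
    proof -
      have Lq: "of_int (X p - X q) * cos t + of_int (Y p - Y q) * sin t = L q t"
        using coords[OF p] coords[OF q(1)] by (metis L_def fst_conv snd_conv of_int_diff)
      have "L q t \<ge> 0" if "\<forall>n. L q t + S n * c q > 0"
      proof (rule LIMSEQ_le_const)
        show "(\<lambda>n. L q t + S n * c q) \<longlonglongrightarrow> L q t"
          using S(3) by (auto intro!: tendsto_eq_intros)
        show "\<exists>N. \<forall>n\<ge>N. 0 \<le> L q t + S n * c q" using that less_imp_le by blast
      qed
      moreover have "L q t + S n * c q > 0" if "L q t \<ge> 0" for n
        using that S(1)[of n] cpos[of q] q by (intro add_nonneg_pos mult_pos_pos) auto
      ultimately show ?thesis unfolding Lq by blast
    qed
    then show ?thesis unfolding V_def critical_angles_def by blast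
  qed
  moreover have "(\<lambda>n. measure lebesgue (V n)) \<longlonglongrightarrow> measure lebesgue (\<Inter>n. V n)"
    using fm dec by (intro Lim_measure_decseq) (auto simp: image_subset_iff simp del: emeasure_completion dest: fmeasurableD fmeasurableD2)
  ultimately show "(\<lambda>n. measure lebesgue {t \<in> {0..<2*pi}. \<forall>q\<in>P. h q < h p \<longrightarrow>
      dist (S n *\<^sub>R p + (cos t, sin t)) (S n *\<^sub>R q) > 1}) \<longlonglongrightarrow> measure lebesgue (critical_angles P h X Y p)"
    unfolding eqV by simp
qed simp

lemma vis_scale_set:
  assumes "eps > 0"
  shows "vis (scale_set eps P) (\<lambda>x. f ((1/eps) *\<^sub>R x)) =
    (\<Sum>p\<in>P. measure lebesgue {t \<in> {0..<2*pi}. \<forall>q\<in>P. f q < f p \<longrightarrow>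
       dist (eps *\<^sub>R p + (cos t, sin t)) (eps *\<^sub>R q) > 1})"
proof -
  have "inj_on (\<lambda>p::real\<times>real. eps *\<^sub>R p) P" using assms by (auto simp: inj_on_def)
  then show ?thesis using assms unfolding vis_def scale_set_def by (simp add: sum.reindex)
qed

section \<open>The choice of k and the final bound\<close>

theorem theorem5:
  "\<exists>K::real. K > 0 \<and>
     (\<forall>(m::nat) (f :: real \<times> real \<Rightarrow> nat).
        bij_betw f (grid m) {1..m^2} \<longrightarrow>
        (\<exists>L. ((\<lambda>eps. vis (scale_set eps (grid m)) (\<lambda>x. f ((1/eps) *\<^sub>R x)))
                \<longlongrightarrow> L) (at_right 0)
             \<and> L \<le> K * real (m^2) powr (2/3)))"
proof (rule exI[of _ "2105::real"], intro conjI allI impI)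
  fix m :: nat and f :: "real \<times> real \<Rightarrow> nat"
  assume f: "bij_betw f (grid m) {1..m^2}"
  define X Y :: "real \<times> real \<Rightarrow> int" where "X p = \<lfloor>fst p\<rfloor>" and "Y p = \<lfloor>snd p\<rfloor>" for p
  have fin: "finite (grid m)" using f by (simp add: bij_betw_finite)
  have card: "card (grid m) = m^2" using bij_betw_same_card[OF f] by simp
  have coords: "p = (of_int (X p), of_int (Y p))" if "p \<in> grid m" for p
    using that by (auto simp: grid_def X_def Y_def)
  define L where "L = (\<Sum>p\<in>grid m. measure lebesgue (critical_angles (grid m) f X Y p))"
  have "((\<lambda>eps. \<Sum>p\<in>grid m. measure lebesgue {t \<in> {0..<2*pi}. \<forall>q\<in>grid m. f q < f p \<longrightarrow>
       dist (eps *\<^sub>R p + (cos t, sin t)) (eps *\<^sub>R q) > 1}) \<longlongrightarrow> L) (at_right 0)"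
    unfolding L_def using fin coords by (intro tendsto_sum tendsto_measure_visible)
  moreover have "eventually (\<lambda>eps. (\<Sum>p\<in>grid m. measure lebesgue {t \<in> {0..<2*pi}. \<forall>q\<in>grid m. f q < f p \<longrightarrow>
       dist (eps *\<^sub>R p + (cos t, sin t)) (eps *\<^sub>R q) > 1}) = vis (scale_set eps (grid m)) (\<lambda>x. f ((1/eps) *\<^sub>R x))) (at_right (0::real))"
    using eventually_at_right_less[of 0] by eventually_elim (rule vis_scale_set[symmetric])
  ultimately have lim: "((\<lambda>eps. vis (scale_set eps (grid m)) (\<lambda>x. f ((1/eps) *\<^sub>R x))) \<longlongrightarrow> L) (at_right 0)"
    by (rule Lim_transform_eventually)
  have "L \<le> 2105 * real (m^2) powr (2/3)"
  proof (cases "m = 0")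
    case True
    then show ?thesis by (simp add: L_def grid_def)
  next
    case False
    \<comment> \<open>In terms of s, m = s^3, n = s^6 and the target is s^4. Rounding s up to an
      integer k at most doubles it, since s >= 1.\<close>
    define s where "s = real m powr (1/3)"
    have s1: "s \<ge> 1" using False by (auto simp: s_def ge_one_powr_ge_zero)
    have m3: "real m = s^3" using False powr_powr[of "real m" "1/3" 3] s1 by (simp add: s_def powr_numeral)
    have s4: "real (m^2) powr (2/3) = s^4"
    proof -
      have "real (m^2) = s powr 6" using s1 by (simp add: m3 powr_numeral flip: power_mult)
      then have "real (m^2) powr (2/3) = s powr 4" by (simp add: powr_powr)
      then show ?thesis using s1 by (simp add: powr_numeral)
    qed
    define k where "k = nat \<lceil>s\<rceil>"
    have ks: "real k \<ge> s" "real k \<le> 2 * s" and k1: "1 \<le> k" using s1 unfolding k_def by linarith+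
    have "L \<le> 5 * (real (card (grid m)) / (real k)^2 + 210 * real m * real k)"
      unfolding L_def
    proof (rule sum_critical_angles_le[OF fin _ _ _ k1])
      show "inj_on f (grid m)" using f by (rule bij_betw_imp_inj_on)
      show "inj_on (\<lambda>p. (X p, Y p)) (grid m)" using coords by (intro inj_onI) (metis prod.inject)
      show "\<bar>X p\<bar> \<le> int m \<and> \<bar>Y p\<bar> \<le> int m" if "p \<in> grid m" for p
        using that by (auto simp: grid_def X_def Y_def)
    qed (use False in simp)
    also have "real (card (grid m)) / (real k)^2 \<le> s^6 / s^2"
    proof -
      have "real (card (grid m)) = s^6" by (simp add: card m3 flip: power_mult)
      then show ?thesis using ks s1 by (simp add: frac_le power_mono)
    qed
    also have "s^6 / s^2 = s^4" using s1 by (simp add: power_diff[symmetric])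
    also have "210 * real m * real k \<le> 210 * real m * (2 * s)" using ks by (intro mult_left_mono) auto
    \<comment> \<open>Both terms are now multiples of s^4, and 5 (1 + 420) = 2105.\<close>
    also have "\<dots> = 420 * s^4" by (simp add: m3 eval_nat_numeral)
    finally show ?thesis unfolding s4 by simp
  qed
  with lim show "\<exists>L. ((\<lambda>eps. vis (scale_set eps (grid m)) (\<lambda>x. f ((1/eps) *\<^sub>R x))) \<longlongrightarrow> L) (at_right 0)
      \<and> L \<le> 2105 * real (m^2) powr (2/3)" by blast
qed simp

end
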